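(* Let $\mathcal{B}=(\mathbf{e}_n)_{n=1}^\infty$ be a semi-normalized Schauder basis of an infinite-dimensional separable (real or complex) Banach space $\mathbb{X}$. Then $\mathcal{B}$ is $1$-greedy if and only if it is $1$-almost greedy and $1$-quasi-greedy.
   Context: Setting: $(\mathbb{X},\Vert\cdot\Vert)$ is an infinite-dimensional separable real or complex Banach space with a Schauder basis $\mathcal{B}=(\mathbf{e}_n)_{n=1}^\infty$ and biorthogonal functionals $(\mathbf{e}_n^* )_{n=1}^\infty$, so that $x=\sum_{n=1}^\infty \mathbf{e}_n^*(x)\mathbf{e}_n$ uniquely for each $x\in\mathbb{X}$. Semi-normalized means $0<\inf_n\Vert \mathbf{e}_n\Vert\le\sup_n\Vert \mathbf{e}_n\Vert<\infty$. $\mathbb{N}=\{1,2,\dots\}$. $\operatorname{supp}(x)=\{n\in\mathbb{N}\colon \mathbf{e}_n^*(x)\neq 0\}$. For finite $A\subset\mathbb{N}$, $P_A(x)=\sum_{n\in A}\mathbf{e}_n^*(x)\mathbf{e}_n$. Greedy orderings: a greedy ordering for $x$ is an injective map $\rho\colon\mathbb{N}\to\mathbb{N}$ with $\operatorname{supp}(x)\subset\rho(\mathbb{N})$ and $|\mathbf{e}_{\rho(i)}^*(x)|\ge|\mathbf{e}_{\rho(j)}^*(x)|$ whenever $i\le j$. The natural greedy ordering for $x$ is the unique greedy ordering $\rho$ such that, for $i\le j$, $\rho(i)\le\rho(j)$ if $|\mathbf{e}_{\rho(i)}^*(x)|=|\mathbf{e}_{\rho(j)}^*(x)|$, and such that $\rho(\mathbb{N})=\mathbb{N}$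 if $x$ is finitely supported (if $x$ is infinitely supported then $\rho(\mathbb{N})=\operatorname{supp}(x)$). The $m$-th natural greedy approximation is $\mathcal{G}_m(x)=\sum_{i=1}^m\mathbf{e}_{\rho(i)}^*(x)\mathbf{e}_{\rho(i)}$ with $\rho$ the natural greedy ordering for $x$. $1$-greedy: for all $x\in\mathbb{X}$ and $m\in\mathbb{N}$, $\Vert x-\mathcal{G}_m(x)\Vert\le\inf\{\Vert x-\sum_{n\in A}\alpha_n\mathbf{e}_n\Vert\colon A\subset\mathbb{N},\ |A|=m,\ \alpha_n \text{ scalars}\}$. $1$-almost greedy: for all $x\in\mathbb{X}$ and $m\in\mathbb{N}$, $\Vert x-\mathcal{G}_m(x)\Vert\le\inf\{\Vert x-P_A(x)\Vert\colon A\subset\mathbb{N},\ |A|=m\}$. Quasi-greedy: $\lim_{m\to\infty}\mathcal{G}_m(x)=x$ for all $x\in\mathbb{X}$; by a theorem of Wojtaszczyk this is equivalent to the operators $\mathcal{G}_m$ being uniformly bounded, i.e. $\sup_m\Vert\mathcal{G}_m(x)\Vert\le C\Vert x\Vert$ for some $C$ and all $x$. For a quasi-greedy basis let $C_w$ and $C_\ell$ be the least constants ($\ge 1$) such that $\Vert\mathcal{G}_m(x)\Vert\le C_w\Vert x\Vert$ and $\Vert x-\mathcal{G}_m(x)\Vert\le C_\ell\Vert x\Vert$ for all $x\in\mathbb{X}$, $m\in\mathbb{N}$, and let $C_{qg}=\max\{C_w,C_\ell\}$. $1$-quasi-greedy: the basis is quasi-greedy with $C_{qg}=1$. *)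

theory Defs
  imports "HOL-Analysis.Analysis"
begin

text \<open>
  Banach spaces over a scalar field \<open>'k\<close> (to be instantiated to \<open>real\<close> and \<open>complex\<close>). HOL-Analysis
  only has a type class for real Banach spaces, so the scalar multiplication is a parameter, which
  has to extend the real one. A complex Banach space is such a structure with \<open>'k = complex\<close>;
  for \<open>'k = real\<close> the assumptions force \<open>scl = scaleR\<close>.
\<close>

locale infinite_dim_separable_banach = vector_space scl
  for scl :: "'k::real_normed_field \<Rightarrow> 'a::banach \<Rightarrow> 'a" +
  assumes norm_scale: "norm (scl c x) = norm c * norm x"
    and scale_of_real: "scl (of_real r) x = r *\<^sub>R x"
    and infinite_dim: "finite B \<Longrightarrow> span B \<noteq> UNIV"
    and separable: "separable_space (euclidean :: 'a topology)"

text \<open>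
  Basis vectors and greedy orderings are indexed by \<open>nat\<close> from 0 rather than from 1: \<open>e n\<close> is the
  basis vector number \<open>n + 1\<close>.
\<close>

definition schauder_basis :: "('k::real_normed_field \<Rightarrow> 'a::banach \<Rightarrow> 'a) \<Rightarrow> (nat \<Rightarrow> 'a) \<Rightarrow> bool" where
  "schauder_basis scl e \<longleftrightarrow> (\<forall>x. \<exists>!a. (\<lambda>n. scl (a n) (e n)) sums x)"

text \<open>The biorthogonal functionals: \<open>coeff_fun scl e n x\<close> is the \<open>n\<close>-th coefficient of \<open>x\<close>.\<close>

definition coeff_fun ::
  "('k::real_normed_field \<Rightarrow> 'a::banach \<Rightarrow> 'a) \<Rightarrow> (nat \<Rightarrow> 'a) \<Rightarrow> nat \<Rightarrow> 'a \<Rightarrow> 'k" where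
  "coeff_fun scl e n x = (THE a. (\<lambda>k. scl (a k) (e k)) sums x) n"

definition semi_normalized :: "(nat \<Rightarrow> 'a::real_normed_vector) \<Rightarrow> bool" where
  "semi_normalized e \<longleftrightarrow> 0 < (INF n. norm (e n)) \<and> bdd_above (range (\<lambda>n. norm (e n)))"

definition basis_supp ::
  "('k::real_normed_field \<Rightarrow> 'a::banach \<Rightarrow> 'a) \<Rightarrow> (nat \<Rightarrow> 'a) \<Rightarrow> 'a \<Rightarrow> nat set" where
  "basis_supp scl e x = {n. coeff_fun scl e n x \<noteq> 0}"

definition basis_proj ::
  "('k::real_normed_field \<Rightarrow> 'a::banach \<Rightarrow> 'a) \<Rightarrow> (nat \<Rightarrow> 'a) \<Rightarrow> nat set \<Rightarrow> 'a \<Rightarrow> 'a" where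
  "basis_proj scl e A x = (\<Sum>n\<in>A. scl (coeff_fun scl e n x) (e n))"

definition greedy_ordering ::
  "('k::real_normed_field \<Rightarrow> 'a::banach \<Rightarrow> 'a) \<Rightarrow> (nat \<Rightarrow> 'a) \<Rightarrow> 'a \<Rightarrow> (nat \<Rightarrow> nat) \<Rightarrow> bool" where
  "greedy_ordering scl e x \<rho> \<longleftrightarrow>
     inj \<rho> \<and> basis_supp scl e x \<subseteq> range \<rho> \<and>
     (\<forall>i j. i \<le> j \<longrightarrow> norm (coeff_fun scl e (\<rho> j) x) \<le> norm (coeff_fun scl e (\<rho> i) x))"

definition is_natural_greedy_ordering ::
  "('k::real_normed_field \<Rightarrow> 'a::banach \<Rightarrow> 'a) \<Rightarrow> (nat \<Rightarrow> 'a) \<Rightarrow> 'a \<Rightarrow> (nat \<Rightarrow> nat) \<Rightarrow> bool" where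
  "is_natural_greedy_ordering scl e x \<rho> \<longleftrightarrow>
     greedy_ordering scl e x \<rho> \<and>
     (\<forall>i j. i \<le> j \<and> norm (coeff_fun scl e (\<rho> i) x) = norm (coeff_fun scl e (\<rho> j) x)
        \<longrightarrow> \<rho> i \<le> \<rho> j) \<and>
     range \<rho> = (if finite (basis_supp scl e x) then UNIV else basis_supp scl e x)"

definition natural_greedy_ordering ::
  "('k::real_normed_field \<Rightarrow> 'a::banach \<Rightarrow> 'a) \<Rightarrow> (nat \<Rightarrow> 'a) \<Rightarrow> 'a \<Rightarrow> nat \<Rightarrow> nat" where
  "natural_greedy_ordering scl e x = (THE \<rho>. is_natural_greedy_ordering scl e x \<rho>)"

definition greedy_approx ::
  "('k::real_normed_field \<Rightarrow> 'a::banach \<Rightarrow> 'a) \<Rightarrow> (nat \<Rightarrow> 'a) \<Rightarrow> nat \<Rightarrow> 'a \<Rightarrow> 'a" where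
  "greedy_approx scl e m x =
     (let \<rho> = natural_greedy_ordering scl e x
      in \<Sum>i<m. scl (coeff_fun scl e (\<rho> i) x) (e (\<rho> i)))"

definition one_greedy ::
  "('k::real_normed_field \<Rightarrow> 'a::banach \<Rightarrow> 'a) \<Rightarrow> (nat \<Rightarrow> 'a) \<Rightarrow> bool" where
  "one_greedy scl e \<longleftrightarrow>
     (\<forall>x. \<forall>m\<ge>1. norm (x - greedy_approx scl e m x)
        \<le> Inf {norm (x - (\<Sum>n\<in>A. scl (\<alpha> n) (e n))) | A \<alpha>. finite A \<and> card A = m})"

definition one_almost_greedy ::
  "('k::real_normed_field \<Rightarrow> 'a::banach \<Rightarrow> 'a) \<Rightarrow> (nat \<Rightarrow> 'a) \<Rightarrow> bool" where
  "one_almost_greedy scl e \<longleftrightarrow>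
     (\<forall>x. \<forall>m\<ge>1. norm (x - greedy_approx scl e m x)
        \<le> Inf {norm (x - basis_proj scl e A x) | A. finite A \<and> card A = m})"

definition quasi_greedy ::
  "('k::real_normed_field \<Rightarrow> 'a::banach \<Rightarrow> 'a) \<Rightarrow> (nat \<Rightarrow> 'a) \<Rightarrow> bool" where
  "quasi_greedy scl e \<longleftrightarrow> (\<forall>x. (\<lambda>m. greedy_approx scl e m x) \<longlonglongrightarrow> x)"

text \<open>
  The least constants of a quasi-greedy basis. They are taken in the extended reals, where the
  infimum of the empty set is \<open>\<infinity>\<close> (so that finiteness means that a bound exists).
  When some admissible constant exists, the infimum is attained, hence is the least one.
\<close>

definition greedy_const_w ::
  "('k::real_normed_field \<Rightarrow> 'a::banach \<Rightarrow> 'a) \<Rightarrow> (nat \<Rightarrow> 'a) \<Rightarrow> ereal" where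
  "greedy_const_w scl e =
     Inf {ereal C | C. 1 \<le> C \<and> (\<forall>x. \<forall>m\<ge>1. norm (greedy_approx scl e m x) \<le> C * norm x)}"

definition greedy_const_l ::
  "('k::real_normed_field \<Rightarrow> 'a::banach \<Rightarrow> 'a) \<Rightarrow> (nat \<Rightarrow> 'a) \<Rightarrow> ereal" where
  "greedy_const_l scl e =
     Inf {ereal C | C. 1 \<le> C \<and> (\<forall>x. \<forall>m\<ge>1. norm (x - greedy_approx scl e m x) \<le> C * norm x)}"

definition quasi_greedy_const ::
  "('k::real_normed_field \<Rightarrow> 'a::banach \<Rightarrow> 'a) \<Rightarrow> (nat \<Rightarrow> 'a) \<Rightarrow> ereal" where
  "quasi_greedy_const scl e = max (greedy_const_w scl e) (greedy_const_l scl e)"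

definition one_quasi_greedy ::
  "('k::real_normed_field \<Rightarrow> 'a::banach \<Rightarrow> 'a) \<Rightarrow> (nat \<Rightarrow> 'a) \<Rightarrow> bool" where
  "one_quasi_greedy scl e \<longleftrightarrow> quasi_greedy scl e \<and> quasi_greedy_const scl e = 1"

end

theory Submission
  imports Defs
begin

text \<open>
  Everything rests on the \<^emph>\<open>suppression property\<close>: deleting finitely many coordinates never
  increases the norm, \<open>\<parallel>x - P\<^sub>A x\<parallel> \<le> \<parallel>x\<parallel>\<close>.

  If the basis is 1-greedy, add to \<open>x\<close> a huge constant \<open>t\<close> at every coordinate in \<open>A\<close>. The greedy
  algorithm then selects \<open>A\<close> and leaves \<open>x - P\<^sub>A x\<close>, while subtracting the added constants
  is a competing approximation that leaves \<open>x\<close>; this is the suppression property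
  (\<open>suppression_if_one_greedy\<close>). It bounds the greedy approximations and their
  remainders by \<open>\<parallel>x\<parallel>\<close>, and it gives their convergence by comparison with the partial sums
  (\<open>one_quasi_greedy_if_suppression\<close>). A 1-greedy basis is 1-almost greedy because projections
  are among the competing approximations.

  Conversely, the bound \<open>\<parallel>G\<^sub>m x\<parallel> \<le> \<parallel>x\<parallel>\<close> yields the suppression property
  (\<open>suppression_if_greedy_approx_contractive\<close>): a finitely supported \<open>y \<noteq> 0\<close> is a greedy
  approximation of \<open>y + c e\<^sub>j\<close> for \<open>j\<close> outside its support and a small scalar \<open>c\<close>, so \<open>0\<close> is a local minimum of
  \<open>c \<mapsto> \<parallel>y + c e\<^sub>j\<parallel>\<close>, and by convexity it is a global one. Finally, for scalars \<open>\<alpha>\<^sub>n\<close>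
  and \<open>z = \<Sum>\<^sub>A \<alpha>\<^sub>n e\<^sub>n\<close>, deleting the coordinates in \<open>A\<close> turns \<open>x - z\<close> into \<open>x - P\<^sub>A x\<close>.
  So the suppression property gives \<open>\<parallel>x - z\<parallel> \<ge> \<parallel>x - P\<^sub>A x\<parallel>\<close>, and the right-hand side is at
  least the greedy error when the basis is 1-almost greedy.
\<close>

section \<open>Enumerating a set of indices by decreasing weight\<close>

text \<open>
  Ordering \<open>S\<close> by decreasing weight, ties broken by the index, gives each element only finitely
  many predecessors, so the order type is that of the natural numbers and the number of
  predecessors of an element is the inverse of the only possible enumeration.
\<close>

lemma ex1_decreasing_enumeration:
  fixes w :: "nat \<Rightarrow> real"
  assumes inf: "infinite S" and fin: "\<And>n. n \<in> S \<Longrightarrow> finite {k \<in> S. w n < w k}"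
  shows "\<exists>!\<rho>::nat \<Rightarrow> nat. inj \<rho> \<and> range \<rho> = S \<and> (\<forall>i j. i \<le> j \<longrightarrow> w (\<rho> j) \<le> w (\<rho> i)) \<and>
    (\<forall>i j. i \<le> j \<and> w (\<rho> i) = w (\<rho> j) \<longrightarrow> \<rho> i \<le> \<rho> j)"
    (is "\<exists>!\<rho>. ?enum \<rho>")
proof -
  define before where "before k n \<longleftrightarrow> w n < w k \<or> w k = w n \<and> k < n" for k n
  define pred where "pred n = {k \<in> S. before k n}" for n
  define rank where "rank n = card (pred n)" for n
  have trans: "before k m" if "before k n" "before n m" for k n m
    using that by (auto simp: before_def)
  have irrefl: "\<not> before n n" for n
    by (auto simp: before_def)
  have linear: "before k n \<or> k = n \<or> before n k" for k n
    by (auto simp: before_def)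
  have fin_pred: "finite (pred n)" if "n \<in> S" for n
  proof -
    have "pred n \<subseteq> {k \<in> S. w n < w k} \<union> {..<n}"
      by (auto simp: pred_def before_def)
    then show ?thesis
      using fin[OF that] by (meson finite_UnI finite_lessThan finite_subset)
  qed
  have rank_less: "rank k < rank n" if "k \<in> S" "n \<in> S" "before k n" for k n
  proof -
    have "pred k \<subset> pred n"
    proof
      show "pred k \<subseteq> pred n"
        using that trans by (auto simp: pred_def)
      have "k \<in> pred n" "k \<notin> pred k"
        using that irrefl by (auto simp: pred_def)
      then show "pred k \<noteq> pred n"
        by blast
    qed
    then show ?thesis
      unfolding rank_def using fin_pred[OF \<open>n \<in> S\<close>] by (rule psubset_card_mono[rotated])
  qed
  have rank_less_iff: "rank k < rank n \<longleftrightarrow> before k n" if "k \<in> S" "n \<in> S" for k n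
    using that rank_less linear by (metis less_asym less_irrefl)
  have inj_rank: "inj_on rank S"
    by (rule inj_onI) (metis linear rank_less less_irrefl)
  have surj_rank: "rank ` S = UNIV"
  proof -
    have "i \<in> rank ` S" for i
    proof -
      have "infinite (rank ` S)"
        using inf inj_rank by (simp add: finite_image_iff)
      then obtain n where n: "n \<in> S" "i < rank n"
        unfolding infinite_nat_iff_unbounded by blast
      have sub: "pred n \<subseteq> S"
        by (auto simp: pred_def)
      have "rank ` pred n \<subseteq> {..<rank n}"
        using n rank_less by (auto simp: pred_def)
      moreover have "card (rank ` pred n) = rank n"
        using card_image[OF inj_on_subset[OF inj_rank sub]] by (simp add: rank_def)
      ultimately have "rank ` pred n = {..<rank n}"
        by (simp add: card_subset_eq)
      then have "i \<in> rank ` pred n"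
        using n by simp
      then show ?thesis
        using sub by blast
    qed
    then show ?thesis by blast
  qed
  have bij: "bij_betw rank S UNIV"
    using inj_rank surj_rank by (simp add: bij_betw_def)
  show ?thesis
  proof (rule ex1I)
    let ?\<rho> = "inv_into S rank"
    have mem: "?\<rho> i \<in> S" and rank: "rank (?\<rho> i) = i" for i
      using surj_rank by (metis UNIV_I inv_into_into, metis UNIV_I f_inv_into_f)
    have increasing: "before (?\<rho> i) (?\<rho> j)" if "i < j" for i j
      using that rank_less_iff[OF mem mem] rank by simp
    have "bij_betw ?\<rho> UNIV S"
      using bij by (rule bij_betw_inv_into)
    moreover have "w (?\<rho> j) \<le> w (?\<rho> i)" if "i \<le> j" for i j
      using that increasing[of i j] by (cases "i = j") (auto simp: before_def)
    moreover have "?\<rho> i \<le> ?\<rho> j" if "i \<le> j" "w (?\<rho> i) = w (?\<rho> j)" for i j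
      using that increasing[of i j] by (cases "i = j") (auto simp: before_def)
    ultimately show "?enum ?\<rho>"
      by (auto simp: bij_betw_def)
  next
    fix \<rho> assume \<rho>: "?enum \<rho>"
    have increasing: "before (\<rho> i) (\<rho> j)" if "i < j" for i j
    proof -
      have "w (\<rho> j) \<le> w (\<rho> i)" "w (\<rho> i) = w (\<rho> j) \<longrightarrow> \<rho> i \<le> \<rho> j" "\<rho> i \<noteq> \<rho> j"
        using \<rho> that by (auto simp: inj_eq)
      then show ?thesis
        by (auto simp: before_def)
    qed
    have "rank (\<rho> i) = i" for i
    proof -
      have "before (\<rho> j) (\<rho> i) \<longleftrightarrow> j < i" for j
        using increasing trans irrefl by (metis linorder_neqE_nat)
      moreover have "S = range \<rho>"
        using \<rho> by blast
      ultimately have "pred (\<rho> i) = \<rho> ` {..<i}"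
        by (auto simp: pred_def)
      moreover have "inj_on \<rho> {..<i}"
        using \<rho> by (auto intro: inj_on_subset)
      ultimately show ?thesis
        by (simp add: rank_def card_image)
    qed
    moreover have "\<rho> i \<in> S" for i
      using \<rho> by blast
    ultimately show "\<rho> = inv_into S rank"
      using inv_into_f_f[OF inj_rank] by (metis ext)
  qed
qed

section \<open>Coefficients and greedy approximations\<close>

locale semi_normalized_schauder_basis = infinite_dim_separable_banach scl
  for scl :: "'k::real_normed_field \<Rightarrow> 'a::banach \<Rightarrow> 'a" +
  fixes e :: "nat \<Rightarrow> 'a"
  assumes basis: "schauder_basis scl e"
    and semi_norm: "semi_normalized e"
begin

abbreviation "coef \<equiv> coeff_fun scl e"
abbreviation "proj \<equiv> basis_proj scl e"
abbreviation "greedy \<equiv> greedy_approx scl e"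

lemma sums_coef: "(\<lambda>n. scl (coef n x) (e n)) sums x"
  using theI'[of "\<lambda>a. (\<lambda>n. scl (a n) (e n)) sums x"] basis
  by (simp add: schauder_basis_def coeff_fun_def)

lemma coef_eqI:
  assumes "(\<lambda>n. scl (a n) (e n)) sums x"
  shows "coef n x = a n"
  using sums_coef[of x] assms basis unfolding schauder_basis_def by metis

lemma coef_add_sum:
  assumes "finite A"
  shows "coef n (x + (\<Sum>k\<in>A. scl (b k) (e k))) = coef n x + (if n \<in> A then b n else 0)"
proof (rule coef_eqI)
  have "(\<lambda>n. scl (coef n x) (e n) + (if n \<in> A then scl (b n) (e n) else 0))
      sums (x + (\<Sum>k\<in>A. scl (b k) (e k)))"
    by (intro sums_add sums_coef sums_If_finite_set assms)
  moreover have "scl (coef n x) (e n) + (if n \<in> A then scl (b n) (e n) else 0)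
      = scl (coef n x + (if n \<in> A then b n else 0)) (e n)" for n
    by (simp add: scale_left_distrib)
  ultimately show "(\<lambda>n. scl (coef n x + (if n \<in> A then b n else 0)) (e n))
      sums (x + (\<Sum>k\<in>A. scl (b k) (e k)))"
    by simp
qed

lemma coef_zero: "coef n 0 = 0"
  by (rule coef_eqI) simp

lemma coef_proj:
  assumes "finite A"
  shows "coef n (proj A x) = (if n \<in> A then coef n x else 0)"
  using coef_add_sum[OF assms, of n 0 "\<lambda>k. coef k x"] by (simp add: basis_proj_def coef_zero)

lemma proj_Diff:
  assumes "finite B" "A \<subseteq> B"
  shows "proj (B - A) x = proj B x - proj A x"
  using assms by (simp add: basis_proj_def sum_diff)

lemma partial_sums_tendsto: "(\<lambda>N. proj {..<N} x) \<longlonglongrightarrow> x"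
  using sums_coef[of x] by (simp add: sums_def basis_proj_def)

text \<open>This is where the lower bound on the norms of the basis vectors enters.\<close>

lemma coef_tendsto_0: "(\<lambda>n. norm (coef n x)) \<longlonglongrightarrow> 0"
proof (rule Lim_null_comparison)
  let ?\<delta> = "INF n. norm (e n)"
  have pos: "0 < ?\<delta>"
    using semi_norm by (simp add: semi_normalized_def)
  have "?\<delta> \<le> norm (e n)" for n
    by (rule cINF_lower) (auto intro: bdd_belowI2[where m = 0])
  then have "norm (coef n x) * ?\<delta> \<le> norm (scl (coef n x) (e n))" for n
    by (simp add: norm_scale mult_left_mono)
  then show "\<forall>\<^sub>F n in sequentially. norm (norm (coef n x)) \<le> norm (scl (coef n x) (e n)) / ?\<delta>"
    using pos by (simp add: pos_le_divide_eq)
  have "(\<lambda>n. scl (coef n x) (e n)) \<longlonglongrightarrow> 0"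
    using sums_coef by (intro summable_LIMSEQ_zero sums_summable)
  then have "(\<lambda>n. norm (scl (coef n x) (e n)) / ?\<delta>) \<longlonglongrightarrow> 0 / ?\<delta>"
    using pos by (intro tendsto_divide tendsto_norm_zero tendsto_const) auto
  then show "(\<lambda>n. norm (scl (coef n x) (e n)) / ?\<delta>) \<longlonglongrightarrow> 0"
    by simp
qed

lemma coef_bounded:
  obtains M where "\<And>n. norm (coef n x) \<le> M"
proof -
  have "Bseq (\<lambda>n. norm (coef n x))"
    using coef_tendsto_0 by (intro convergent_imp_Bseq convergentI)
  then show thesis
    using that by (auto simp: Bseq_def)
qed

lemma finite_larger_coef:
  assumes "coef n x \<noteq> 0"
  shows "finite {k. norm (coef n x) < norm (coef k x)}"
proof -
  have "\<forall>\<^sub>F k in sequentially. norm (coef k x) < norm (coef n x)"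
    using coef_tendsto_0 assms by (intro order_tendstoD) auto
  then have "finite {k. \<not> norm (coef k x) < norm (coef n x)}"
    by (simp add: eventually_cofinite flip: cofinite_eq_sequentially)
  then show ?thesis
    by (rule rev_finite_subset) auto
qed

lemma natural_greedy_ordering:
  "is_natural_greedy_ordering scl e x (natural_greedy_ordering scl e x)"
proof -
  let ?S = "if finite (basis_supp scl e x) then UNIV else basis_supp scl e x"
  let ?w = "\<lambda>n. norm (coef n x)"
  have "finite {k \<in> ?S. ?w n < ?w k}" if "n \<in> ?S" for n
  proof (cases "coef n x = 0")
    case True
    \<comment> \<open>An index with zero coefficient is enumerated only if the support is finite.\<close>
    then have "finite (basis_supp scl e x)"
      using that by (auto simp: basis_supp_def split: if_splits)
    then show ?thesis
      by (rule rev_finite_subset) (use True in \<open>auto simp: basis_supp_def\<close>)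
  next
    case False
    from finite_larger_coef[OF this] show ?thesis
      by (rule rev_finite_subset) auto
  qed
  moreover have "infinite ?S"
    by simp
  ultimately have "\<exists>!\<rho>::nat \<Rightarrow> nat. inj \<rho> \<and> range \<rho> = ?S \<and> (\<forall>i j. i \<le> j \<longrightarrow> ?w (\<rho> j) \<le> ?w (\<rho> i)) \<and>
      (\<forall>i j. i \<le> j \<and> ?w (\<rho> i) = ?w (\<rho> j) \<longrightarrow> \<rho> i \<le> \<rho> j)"
    by (intro ex1_decreasing_enumeration)
  moreover have "is_natural_greedy_ordering scl e x \<rho> \<longleftrightarrow>
      inj \<rho> \<and> range \<rho> = ?S \<and> (\<forall>i j. i \<le> j \<longrightarrow> ?w (\<rho> j) \<le> ?w (\<rho> i)) \<and>
      (\<forall>i j. i \<le> j \<and> ?w (\<rho> i) = ?w (\<rho> j) \<longrightarrow> \<rho> i \<le> \<rho> j)" for \<rho>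
    unfolding is_natural_greedy_ordering_def greedy_ordering_def by auto
  ultimately have "\<exists>!\<rho>. is_natural_greedy_ordering scl e x \<rho>"
    by simp
  then show ?thesis
    unfolding natural_greedy_ordering_def by (rule theI')
qed

lemma natural_greedy_ordering_facts:
  defines "\<rho> x \<equiv> natural_greedy_ordering scl e x"
  shows inj_ordering: "inj (\<rho> x)"
    and supp_ordering: "coef n x \<noteq> 0 \<Longrightarrow> n \<in> range (\<rho> x)"
    and decreasing_ordering: "i \<le> j \<Longrightarrow> norm (coef (\<rho> x j) x) \<le> norm (coef (\<rho> x i) x)"
  using natural_greedy_ordering[of x]
  by (auto simp: is_natural_greedy_ordering_def greedy_ordering_def basis_supp_def \<rho>_def)

lemma greedy_eq_proj: "greedy m x = proj (natural_greedy_ordering scl e x ` {..<m}) x"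
  using inj_ordering[of x]
  by (simp add: greedy_approx_def basis_proj_def Let_def sum.reindex inj_on_subset)

text \<open>
  The strict gap between the coefficients inside and outside \<open>A\<close> forces every greedy
  ordering of \<open>x\<close> to exhaust \<open>A\<close> first.
\<close>

lemma greedy_eq_projI:
  assumes A: "finite A" "card A = m"
    and larger: "\<And>n k. n \<in> A \<Longrightarrow> k \<notin> A \<Longrightarrow> norm (coef k x) < norm (coef n x)"
  shows "greedy m x = proj A x"
proof -
  let ?\<rho> = "natural_greedy_ordering scl e x"
  let ?G = "?\<rho> ` {..<m}"
  have "card ?G = m"
    by (simp add: card_image inj_on_subset[OF inj_ordering])
  have "A \<subseteq> ?G"
  proof (rule ccontr)
    assume "\<not> A \<subseteq> ?G"
    then obtain n where n: "n \<in> A" "n \<notin> ?G" by blast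
    have "\<not> ?G \<subseteq> A"
      using n A \<open>card ?G = m\<close> by (metis card_subset_eq)
    then obtain i where i: "i < m" "?\<rho> i \<notin> A" by blast
    have less: "norm (coef (?\<rho> i) x) < norm (coef n x)"
      using larger n i by blast
    then have "coef n x \<noteq> 0" by auto
    then obtain j where j: "n = ?\<rho> j"
      using supp_ordering by blast
    then have "i \<le> j"
      using n i by (auto simp: not_less[symmetric])
    then show False
      using decreasing_ordering[of i j x] less j by simp
  qed
  then have "A = ?G"
    using A \<open>card ?G = m\<close> by (intro card_subset_eq) auto
  then show ?thesis
    by (simp add: greedy_eq_proj)
qed

section \<open>The suppression property\<close>

definition suppression :: bool where
  "suppression \<longleftrightarrow> (\<forall>A x. finite A \<longrightarrow> norm (x - proj A x) \<le> norm x)"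

lemma norm_proj_le:
  assumes "suppression" "finite A"
  shows "norm (proj A x) \<le> norm x"
proof (rule LIMSEQ_le_const)
  show "(\<lambda>N. norm (proj {..<N} x)) \<longlonglongrightarrow> norm x"
    by (intro tendsto_norm partial_sums_tendsto)
  obtain N0 where N0: "A \<subseteq> {..<N0}"
    using \<open>finite A\<close> finite_nat_bounded by blast
  \<comment> \<open>The projection to \<open>A\<close> of a partial sum deletes only finitely many coordinates.\<close>
  have "norm (proj A x) \<le> norm (proj {..<N} x)" if "N0 \<le> N" for N
  proof -
    let ?B = "{..<N} - A"
    have "A \<subseteq> {..<N}"
      using N0 that by auto
    then have "proj A x = proj {..<N} x - proj ?B x"
      by (simp add: proj_Diff)
    also have "proj ?B x = proj ?B (proj {..<N} x)"
      by (simp add: basis_proj_def[of _ _ ?B] coef_proj)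
    finally show ?thesis
      using \<open>suppression\<close> by (simp add: suppression_def)
  qed
  then show "\<exists>N. \<forall>n\<ge>N. norm (proj A x) \<le> norm (proj {..<n} x)"
    by blast
qed

text \<open>
  Once the set selected by the greedy algorithm contains all support indices below \<open>N\<close>, the
  remainder \<open>x - G\<^sub>m x\<close> arises from \<open>x - S\<^sub>N x\<close> by deleting coordinates, where \<open>S\<^sub>N x\<close> is the
  partial sum of the first \<open>N\<close> terms, so its norm is at most \<open>\<parallel>x - S\<^sub>N x\<parallel>\<close>.
\<close>

lemma quasi_greedy_if_suppression:
  assumes "suppression"
  shows "quasi_greedy scl e"
  unfolding quasi_greedy_def
proof (intro allI LIMSEQ_I)
  fix x and r :: real assume "0 < r"
  let ?\<rho> = "natural_greedy_ordering scl e x"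
  obtain N where N: "norm (proj {..<N} x - x) < r"
    using LIMSEQ_D[OF partial_sums_tendsto \<open>0 < r\<close>] by blast
  let ?F = "{n. n < N \<and> coef n x \<noteq> 0}"
  have "?F \<subseteq> range ?\<rho>"
    using supp_ordering by blast
  moreover have "finite ?F"
    by simp
  ultimately obtain I where I: "finite I" "?F = ?\<rho> ` I"
    using finite_subset_image[of ?F ?\<rho> UNIV] by metis
  obtain M where M: "I \<subseteq> {..<M}"
    using I finite_nat_bounded by blast
  have "norm (greedy m x - x) < r" if "M \<le> m" for m
  proof -
    let ?G = "?\<rho> ` {..<m}"
    define y where "y = x - proj {..<N} x"
    have "I \<subseteq> {..<m}"
      using M that by auto
    then have F: "?F \<subseteq> ?G"
      using I by (simp add: image_mono)
    have coef_y: "coef n y = (if n < N then 0 else coef n x)" for n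
      using coef_add_sum[of "{..<N}" n x "\<lambda>k. - coef k x"]
      by (simp add: y_def basis_proj_def sum_negf)
    have "proj {..<N} x = proj (?G \<inter> {..<N}) x"
      unfolding basis_proj_def using F by (intro sum.mono_neutral_right) auto
    moreover have "proj ?G y = proj (?G - {..<N}) x"
      unfolding basis_proj_def
      by (rule sum.mono_neutral_cong_right) (auto simp: coef_y)
    moreover have "proj ?G x = proj (?G \<inter> {..<N}) x + proj (?G - {..<N}) x"
      unfolding basis_proj_def by (intro sum.Int_Diff) auto
    ultimately have "y - proj ?G y = x - proj ?G x"
      by (simp add: y_def)
    then have "norm (x - greedy m x) \<le> norm y"
      using assms unfolding suppression_def greedy_eq_proj by (metis finite_imageI finite_lessThan)
    then show ?thesis
      using N by (simp add: y_def norm_minus_commute)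
  qed
  then show "\<exists>M. \<forall>m\<ge>M. norm (greedy m x - x) < r"
    by blast
qed

lemma one_quasi_greedy_if_suppression:
  assumes "suppression"
  shows "one_quasi_greedy scl e"
proof -
  have "greedy_const_w scl e = 1"
    unfolding greedy_const_w_def
  proof (rule antisym)
    have "norm (greedy m x) \<le> 1 * norm x" for m x
      using norm_proj_le[OF assms] by (simp add: greedy_eq_proj)
    then show "Inf {ereal C | C. 1 \<le> C \<and> (\<forall>x. \<forall>m\<ge>1. norm (greedy m x) \<le> C * norm x)} \<le> 1"
      by (intro Inf_lower) (auto simp: one_ereal_def)
  qed (auto intro!: Inf_greatest)
  moreover have "greedy_const_l scl e = 1"
    unfolding greedy_const_l_def
  proof (rule antisym)
    have "norm (x - greedy m x) \<le> 1 * norm x" for m x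
      using assms by (simp add: greedy_eq_proj suppression_def)
    then show "Inf {ereal C | C. 1 \<le> C \<and>
        (\<forall>x. \<forall>m\<ge>1. norm (x - greedy m x) \<le> C * norm x)} \<le> 1"
      by (intro Inf_lower) (auto simp: one_ereal_def)
  qed (auto intro!: Inf_greatest)
  ultimately show ?thesis
    using quasi_greedy_if_suppression[OF assms]
    by (simp add: one_quasi_greedy_def quasi_greedy_const_def)
qed

lemma greedy_approx_contractive:
  assumes "one_quasi_greedy scl e" "1 \<le> m"
  shows "norm (greedy m x) \<le> norm x"
proof (cases "norm x = 0")
  case True
  then show ?thesis
    by (simp add: greedy_eq_proj basis_proj_def coef_zero)
next
  case False
  show ?thesis
  \<comment> \<open>The infimum \<open>C\<^sub>w = 1\<close> provides admissible constants arbitrarily close to 1.\<close>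
  proof (rule field_le_epsilon)
    fix \<epsilon> :: real assume "0 < \<epsilon>"
    have "greedy_const_w scl e \<le> 1"
      using assms unfolding one_quasi_greedy_def quasi_greedy_const_def by (metis max.cobounded1)
    also have "1 < ereal (1 + \<epsilon> / norm x)"
      using False \<open>0 < \<epsilon>\<close> by (simp add: one_ereal_def)
    finally obtain C where "C < 1 + \<epsilon> / norm x" "norm (greedy m x) \<le> C * norm x"
      using \<open>1 \<le> m\<close> by (auto simp: greedy_const_w_def Inf_less_iff)
    then have "norm (greedy m x) \<le> (1 + \<epsilon> / norm x) * norm x"
      by (meson less_imp_le mult_right_mono norm_ge_zero order_trans)
    then show "norm (greedy m x) \<le> norm x + \<epsilon>"
      using False by (simp add: algebra_simps)
  qed
qed

text \<open>
  Let \<open>y = P\<^sub>F x\<close>. For small \<open>s > 0\<close> the perturbation \<open>s x\<^sub>j\<close> is smaller than all nonzero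
  coefficients of \<open>y\<close>, so \<open>y\<close> is a greedy approximation of \<open>y + s x\<^sub>j e\<^sub>j\<close> and cannot have larger
  norm. Since \<open>y + s x\<^sub>j e\<^sub>j\<close> lies on the segment from \<open>y\<close> to \<open>y + x\<^sub>j e\<^sub>j\<close>, convexity of the norm
  transports the inequality to the far end.
\<close>

lemma norm_proj_le_norm_proj_insert:
  assumes contr: "\<And>m x. 1 \<le> m \<Longrightarrow> norm (greedy m x) \<le> norm x"
    and F: "finite F" "j \<notin> F"
  shows "norm (proj F x) \<le> norm (proj (insert j F) x)"
proof -
  let ?A = "{n \<in> F. coef n x \<noteq> 0}"
  let ?y = "proj F x" and ?c = "coef j x"
  have "finite ?A"
    using F by simp
  show ?thesis
  proof (cases "?A = {}")
    case True
    then have "?y = 0"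
      by (auto simp: basis_proj_def intro!: sum.neutral)
    then show ?thesis by simp
  next
    case False
    define \<mu> where "\<mu> = Min ((\<lambda>n. norm (coef n x)) ` ?A)"
    have "0 < \<mu>"
      using \<open>finite ?A\<close> False by (simp add: \<mu>_def)
    have \<mu>_le: "\<mu> \<le> norm (coef n x)" if "n \<in> ?A" for n
      unfolding \<mu>_def using \<open>finite ?A\<close> that by (intro Min_le) auto
    \<comment> \<open>Chosen such that \<open>s \<le> 1\<close> and \<open>s \<bar>x\<^sub>j\<bar> < \<mu>\<close>, also when \<open>x\<^sub>j\<close> is zero or large.\<close>
    define s where "s = \<mu> / (\<mu> + norm ?c)"
    have s: "0 < s" "s \<le> 1"
      using \<open>0 < \<mu>\<close> by (auto simp: s_def add_pos_nonneg divide_le_eq_1)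
    have small: "norm (of_real s * ?c) < \<mu>"
    proof -
      have "norm (of_real s * ?c) = s * norm ?c"
        using s by (simp add: norm_mult)
      also have "\<dots> < \<mu>"
        using \<open>0 < \<mu>\<close> by (simp add: s_def divide_less_eq add_pos_nonneg distrib_left)
      finally show ?thesis .
    qed
    define z where "z = ?y + scl (of_real s * ?c) (e j)"
    have coef_z: "coef n z = (if n \<in> F then coef n x else if n = j then of_real s * ?c else 0)"
      for n
      using coef_add_sum[of "{j}" n ?y "\<lambda>_. of_real s * ?c"] F
      by (simp add: z_def coef_proj)
    have "greedy (card ?A) z = proj ?A z"
    proof (rule greedy_eq_projI)
      fix n k assume n: "n \<in> ?A" and k: "k \<notin> ?A"
      have "norm (coef k z) < \<mu>"
        using k small \<open>0 < \<mu>\<close> by (auto simp: coef_z)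
      also have "\<mu> \<le> norm (coef n z)"
        using \<mu>_le[OF n] n by (simp add: coef_z)
      finally show "norm (coef k z) < norm (coef n z)" .
    qed (use F in auto)
    also have "proj ?A z = ?y"
      unfolding basis_proj_def using F
      by (intro sum.mono_neutral_cong_left) (auto simp: coef_z)
    finally have "greedy (card ?A) z = ?y" .
    moreover have "1 \<le> card ?A"
      using \<open>finite ?A\<close> False by (simp add: Suc_le_eq card_gt_0_iff)
    ultimately have "norm ?y \<le> norm z"
      using contr by metis
    also have "z = (1 - s) *\<^sub>R ?y + s *\<^sub>R (proj (insert j F) x)"
      using F by (simp add: z_def basis_proj_def scale_of_real algebra_simps flip: scale_scale)
    also have "norm \<dots> \<le> (1 - s) * norm ?y + s * norm (proj (insert j F) x)"
      using s by (metis abs_of_nonneg abs_of_pos diff_ge_0_iff_ge norm_scaleR norm_triangle_ineq)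
    finally have "s * norm ?y \<le> s * norm (proj (insert j F) x)"
      by (simp add: algebra_simps)
    then show ?thesis
      using s by simp
  qed
qed

text \<open>
  Restoring one coordinate at a time gives the property for the partial sums of \<open>x\<close>, and it
  passes to their limit.
\<close>

lemma suppression_if_greedy_approx_contractive:
  assumes contr: "\<And>m x. 1 \<le> m \<Longrightarrow> norm (greedy m x) \<le> norm x"
  shows "suppression"
  unfolding suppression_def
proof (intro allI impI)
  fix A :: "nat set" and x assume "finite A"
  have mono: "norm (proj F x) \<le> norm (proj (F \<union> B) x)" if "finite F" "finite B" for F B
    using \<open>finite B\<close>
  proof induction
    case (insert j B)
    have "norm (proj (F \<union> B) x) \<le> norm (proj (insert j (F \<union> B)) x)"
      by (cases "j \<in> F \<union> B")
        (simp_all add: insert_absorb norm_proj_le_norm_proj_insert[OF contr] \<open>finite F\<close> insert)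
    then show ?case
      using insert by simp
  qed simp
  obtain N0 where N0: "A \<subseteq> {..<N0}"
    using \<open>finite A\<close> finite_nat_bounded by blast
  show "norm (x - proj A x) \<le> norm x"
  proof (rule LIMSEQ_le)
    show "(\<lambda>N. norm (proj {..<N} x - proj A x)) \<longlonglongrightarrow> norm (x - proj A x)"
      by (intro tendsto_intros partial_sums_tendsto)
    show "(\<lambda>N. norm (proj {..<N} x)) \<longlonglongrightarrow> norm x"
      by (intro tendsto_intros partial_sums_tendsto)
    have "norm (proj {..<N} x - proj A x) \<le> norm (proj {..<N} x)" if "N0 \<le> N" for N
    proof -
      have "A \<subseteq> {..<N}"
        using N0 that by auto
      then have "({..<N} - A) \<union> A = {..<N}" by auto
      then show ?thesis
        using mono[of "{..<N} - A" A] \<open>finite A\<close> \<open>A \<subseteq> {..<N}\<close> by (simp add: proj_Diff)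
    qed
    then show "\<exists>N. \<forall>n\<ge>N. norm (proj {..<n} x - proj A x) \<le> norm (proj {..<n} x)"
      by blast
  qed
qed

section \<open>Comparing greedy errors with best approximation errors\<close>

lemma one_greedy_iff:
  "one_greedy scl e \<longleftrightarrow> (\<forall>x A \<alpha>. finite A \<and> A \<noteq> {} \<longrightarrow>
     norm (x - greedy (card A) x) \<le> norm (x - (\<Sum>n\<in>A. scl (\<alpha> n) (e n))))"
proof -
  let ?E = "\<lambda>x m. {norm (x - (\<Sum>n\<in>A. scl (\<alpha> n) (e n))) | A \<alpha>. finite A \<and> card A = m}"
  have "?E x m \<noteq> {}" for x m
    by (auto intro!: exI[of _ "{..<m}"])
  moreover have "bdd_below (?E x m)" for x m
    by (rule bdd_belowI[of _ 0]) auto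
  ultimately have "c \<le> Inf (?E x m) \<longleftrightarrow> (\<forall>v\<in>?E x m. c \<le> v)" for c x m
    by (rule le_cInf_iff)
  then have "one_greedy scl e \<longleftrightarrow> (\<forall>x. \<forall>m\<ge>1. \<forall>v\<in>?E x m. norm (x - greedy m x) \<le> v)"
    by (simp add: one_greedy_def)
  also have "\<dots> \<longleftrightarrow> (\<forall>x A \<alpha>. finite A \<and> 1 \<le> card A \<longrightarrow>
      norm (x - greedy (card A) x) \<le> norm (x - (\<Sum>n\<in>A. scl (\<alpha> n) (e n))))"
    by blast
  also have "(\<lambda>A::nat set. finite A \<and> 1 \<le> card A) = (\<lambda>A. finite A \<and> A \<noteq> {})"
    by (auto simp: Suc_le_eq card_gt_0_iff)
  finally show ?thesis .
qed

lemma one_almost_greedy_iff: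
  "one_almost_greedy scl e \<longleftrightarrow> (\<forall>x A. finite A \<and> A \<noteq> {} \<longrightarrow>
     norm (x - greedy (card A) x) \<le> norm (x - proj A x))"
proof -
  let ?E = "\<lambda>x m. {norm (x - proj A x) | A. finite A \<and> card A = m}"
  have "?E x m \<noteq> {}" for x m
    by (auto intro!: exI[of _ "{..<m}"])
  moreover have "bdd_below (?E x m)" for x m
    by (rule bdd_belowI[of _ 0]) auto
  ultimately have "c \<le> Inf (?E x m) \<longleftrightarrow> (\<forall>v\<in>?E x m. c \<le> v)" for c x m
    by (rule le_cInf_iff)
  then have "one_almost_greedy scl e \<longleftrightarrow> (\<forall>x. \<forall>m\<ge>1. \<forall>v\<in>?E x m. norm (x - greedy m x) \<le> v)"
    by (simp add: one_almost_greedy_def)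
  also have "\<dots> \<longleftrightarrow> (\<forall>x A. finite A \<and> 1 \<le> card A \<longrightarrow>
      norm (x - greedy (card A) x) \<le> norm (x - proj A x))"
    by blast
  also have "(\<lambda>A::nat set. finite A \<and> 1 \<le> card A) = (\<lambda>A. finite A \<and> A \<noteq> {})"
    by (auto simp: Suc_le_eq card_gt_0_iff)
  finally show ?thesis .
qed

lemma one_almost_greedy_if_one_greedy:
  assumes "one_greedy scl e"
  shows "one_almost_greedy scl e"
  using assms by (simp add: one_greedy_iff one_almost_greedy_iff basis_proj_def)

lemma suppression_if_one_greedy:
  assumes "one_greedy scl e"
  shows "suppression"
  unfolding suppression_def
proof (intro allI impI)
  fix A :: "nat set" and x assume A: "finite A"
  show "norm (x - proj A x) \<le> norm x"
  proof (cases "A = {}")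
    case True
    then show ?thesis by (simp add: basis_proj_def)
  next
    case False
    obtain M where M: "\<And>n. norm (coef n x) \<le> M"
      using coef_bounded by blast
    then have "0 \<le> M"
      using norm_ge_zero order_trans by blast
    \<comment> \<open>Adding \<open>t\<close> lifts the modulus of a coefficient above \<open>M\<close>, whatever its argument is.\<close>
    define t :: 'k where "t = of_real (2 * M + 1)"
    define y where "y = x + (\<Sum>n\<in>A. scl t (e n))"
    have coef_y: "coef n y = coef n x + (if n \<in> A then t else 0)" for n
      unfolding y_def using coef_add_sum[OF A, of n x "\<lambda>_. t"] by simp
    have "greedy (card A) y = proj A y"
    proof (rule greedy_eq_projI[OF A refl])
      fix n k assume n: "n \<in> A" and k: "k \<notin> A"
      have "norm t = 2 * M + 1"
        using \<open>0 \<le> M\<close> by (simp only: t_def norm_of_real abs_of_nonneg)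
      moreover have "norm t - norm (coef n x) \<le> norm (t + coef n x)"
        by (rule norm_diff_ineq)
      ultimately have "M < norm (coef n y)"
        using M[of n] n by (simp add: coef_y add.commute)
      then show "norm (coef k y) < norm (coef n y)"
        using M[of k] k by (simp add: coef_y)
    qed
    also have "proj A y = proj A x + (\<Sum>n\<in>A. scl t (e n))"
      by (simp add: basis_proj_def coef_y scale_left_distrib sum.distrib)
    finally have "x - proj A x = y - greedy (card A) y"
      by (simp add: y_def)
    also have "norm \<dots> \<le> norm (y - (\<Sum>n\<in>A. scl t (e n)))"
      using assms A False unfolding one_greedy_iff by (elim allE[of _ "\<lambda>_. t"] allE) blast
    also have "y - (\<Sum>n\<in>A. scl t (e n)) = x"
      by (simp add: y_def)
    finally show ?thesis .
  qed
qed

lemma one_greedy_if_one_almost_greedy_suppression: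
  assumes almost: "one_almost_greedy scl e" and "suppression"
  shows "one_greedy scl e"
  unfolding one_greedy_iff
proof (intro allI impI)
  fix x and A :: "nat set" and \<alpha> :: "nat \<Rightarrow> 'k"
  assume A: "finite A \<and> A \<noteq> {}"
  let ?z = "\<Sum>n\<in>A. scl (\<alpha> n) (e n)"
  have "norm (x - greedy (card A) x) \<le> norm (x - proj A x)"
    using almost A by (simp add: one_almost_greedy_iff)
  also have "x - proj A x = (x - ?z) - proj A (x - ?z)"
  proof -
    have "coef n (x - ?z) = coef n x - \<alpha> n" if "n \<in> A" for n
      using coef_add_sum[of A n x "\<lambda>k. - \<alpha> k"] A that by (simp add: sum_negf)
    then have "proj A (x - ?z) = proj A x - ?z"
      by (simp add: basis_proj_def scale_left_diff_distrib sum_subtractf)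
    then show ?thesis by simp
  qed
  also have "norm \<dots> \<le> norm (x - ?z)"
    using \<open>suppression\<close> A by (simp add: suppression_def)
  finally show "norm (x - greedy (card A) x) \<le> norm (x - ?z)" .
qed

theorem one_greedy_iff_one_almost_greedy_one_quasi_greedy:
  "one_greedy scl e \<longleftrightarrow> one_almost_greedy scl e \<and> one_quasi_greedy scl e"
proof
  assume "one_greedy scl e"
  then show "one_almost_greedy scl e \<and> one_quasi_greedy scl e"
    using one_almost_greedy_if_one_greedy suppression_if_one_greedy
      one_quasi_greedy_if_suppression by blast
next
  assume *: "one_almost_greedy scl e \<and> one_quasi_greedy scl e"
  then have "suppression"
    using greedy_approx_contractive by (intro suppression_if_greedy_approx_contractive) blast
  with * show "one_greedy scl e"
    using one_greedy_if_one_almost_greedy_suppression by blast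
qed

end

theorem corollary2p7:
  fixes rscale :: "real \<Rightarrow> 'a::banach \<Rightarrow> 'a" and e :: "nat \<Rightarrow> 'a"
    and cscale :: "complex \<Rightarrow> 'b::banach \<Rightarrow> 'b" and f :: "nat \<Rightarrow> 'b"
  shows
    "(infinite_dim_separable_banach rscale \<and> schauder_basis rscale e \<and> semi_normalized e \<longrightarrow>
        (one_greedy rscale e \<longleftrightarrow> one_almost_greedy rscale e \<and> one_quasi_greedy rscale e))
     \<and>
     (infinite_dim_separable_banach cscale \<and> schauder_basis cscale f \<and> semi_normalized f \<longrightarrow>
        (one_greedy cscale f \<longleftrightarrow> one_almost_greedy cscale f \<and> one_quasi_greedy cscale f))"
proof (intro conjI impI)
  assume "infinite_dim_separable_banach rscale \<and> schauder_basis rscale e \<and> semi_normalized e"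
  then interpret semi_normalized_schauder_basis rscale e
    by (simp add: semi_normalized_schauder_basis_def semi_normalized_schauder_basis_axioms_def)
  show "one_greedy rscale e \<longleftrightarrow> one_almost_greedy rscale e \<and> one_quasi_greedy rscale e"
    by (rule one_greedy_iff_one_almost_greedy_one_quasi_greedy)
next
  assume "infinite_dim_separable_banach cscale \<and> schauder_basis cscale f \<and> semi_normalized f"
  then interpret semi_normalized_schauder_basis cscale f
    by (simp add: semi_normalized_schauder_basis_def semi_normalized_schauder_basis_axioms_def)
  show "one_greedy cscale f \<longleftrightarrow> one_almost_greedy cscale f \<and> one_quasi_greedy cscale f"
    by (rule one_greedy_iff_one_almost_greedy_one_quasi_greedy)
qed

end
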